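(* Let $(x^k)_{k\ge 0}\subset L^{p(\cdot)}(\Omega)$ be a sequence generated by the modular-proximal gradient algorithm described in the context, and let $r_k:=\phi(x^k)-\bar\phi$ for $k\ge 1$. If $(x^k)_k$ is bounded in $L^{p(\cdot)}(\Omega)$, then there exists a constant $\eta>0$ such that $$ r_k\le \eta\,\frac{1}{k^{\,p_- -1}}\qquad\text{for all } k\ge 1. $$
   Context: Space. $\Omega\subseteq\mathbb R^d$ ($d\ge 1$) is Lebesgue measurable with positive measure, $p(\cdot):\Omega\to[1,+\infty]$ is Lebesgue measurable, $p_-:=\operatorname{ess\,inf}_\Omega p$, $p_+:=\operatorname{ess\,sup}_\Omega p$, and $1<p_-\le p_+\le 2$. For measurable $x$ on $\Omega$ (identified up to a.e. equality) set $$\rho_{p(\cdot)}(x)=\int_\Omega |x(t)|^{p(t)}\,dt,\qquad \bar\rho_{p(\cdot)}(x)=\int_\Omega \frac1{p(t)}|x(t)|^{p(t)}\,dt .$$ $L^{p(\cdot)}(\Omega)$ is the set of measurable $x$ with $\rho_{p(\cdot)}(x/\lambda)\le 1$ for some $\lambda>0$, normed by $\|x\|_{L^{p(\cdot)}}=\inf\{\lambda>0:\rho_{p(\cdot)}(x/\lambda)\le1\}$; it is a Banach space. $L^{p(\cdot)}(\Omega)^*$ is its dual with the operator norm $\|\cdot\|_{(L^{p(\cdot)})^*}$, and $\langle\cdot,\cdot\rangle$ is the duality pairing. Problem. $f:L^{p(\cdot)}(\Omega)\to\mathbb R\cup\{+\infty\}$ is proper, convex and Gateaux differentiable, with gradient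 $\nabla f:L^{p(\cdot)}(\Omega)\to L^{p(\cdot)}(\Omega)^*$; $g:L^{p(\cdot)}(\Omega)\to\mathbb R\cup\{+\infty\}$ is proper, convex and lower semicontinuous; $\phi:=f+g$, $\bar\phi:=\inf\phi$, and the solution set $\mathrm{Sol}(P):=\{x\in L^{p(\cdot)}(\Omega):\phi(x)=\bar\phi\}$ is nonempty. There are $\mathtt p$ with $p_+\le \mathtt p\le 2$ and $K>0$ such that $\|\nabla f(u)-\nabla f(v)\|_{(L^{p(\cdot)})^*}\le K\|u-v\|_{L^{p(\cdot)}}^{\mathtt p-1}$ for all $u,v\in L^{p(\cdot)}(\Omega)$. Algorithm. Start from $x^0\in L^{p(\cdot)}(\Omega)$. For $k=0,1,\dots$ set $$x^{k+1}=\operatorname*{arg\,min}_{x\in L^{p(\cdot)}(\Omega)}\ \bar\rho_{p(\cdot)}(x-x^k)+\tau_k\langle\nabla f(x^k),x\rangle+\tau_k g(x),$$ where the step-size $\tau_k$ is found by a backtracking loop (repeatedly multiplying it by powers of a fixed $\rho\in(0,1)$) until $\rho_{p(\cdot)}(x^k-x^{k+1})<1$. The accepted step-sizes, denoted $\tau_k$, satisfy $$0<\bar\tau\le\tau_k\le\frac{\mathtt p(1-\delta)}{K}$$ for fixed constants $\bar\tau>0$ and $0<\delta<1$. Thus every generated sequence satisfies both the minimization rule $x^{k+1}=\operatorname*{arg\,min}_{x\in L^{p(\cdot)}(\Omega)}\ \bar\rho_{p(\cdot)}(x-x^k)+\tau_k\langle\nabla f(x^k),x\rangle+\tau_k g(x)$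 and $\rho_{p(\cdot)}(x^k-x^{k+1})<1$ for all $k\ge0$. *)

theory Defs
  imports "HOL-Analysis.Analysis" "HOL-Probability.Essential_Supremum"
begin

text \<open>
  Elements of the variable exponent space are represented by measurable functions. Identification
  up to a.e. equality is expressed by working with the induced seminorm and by requiring that
  functionals take the same value on a.e. equal representatives (see \<open>ext_functional\<close>).
  In the application the measure is \<open>lebesgue_on \<Omega>\<close>, so values outside \<open>\<Omega>\<close> are irrelevant.
\<close>

definition essinf :: "'a measure \<Rightarrow> ('a \<Rightarrow> ereal) \<Rightarrow> ereal"
  where "essinf M p = - esssup M (\<lambda>t. - p t)"

text \<open>
  In the two modulars the exponent is converted by \<open>real_of_ereal\<close>, which sends \<open>\<infinity>\<close> to 0. They are
  therefore the intended ones only for exponents that are finite a.e., which holds whenever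
  \<open>esssup M p < \<infinity>\<close>.
\<close>

definition vexp_modular :: "'a measure \<Rightarrow> ('a \<Rightarrow> ereal) \<Rightarrow> ('a \<Rightarrow> real) \<Rightarrow> ennreal"
  where "vexp_modular M p x = (\<integral>\<^sup>+ t. ennreal (\<bar>x t\<bar> powr real_of_ereal (p t)) \<partial>M)"

definition vexp_modular_bar :: "'a measure \<Rightarrow> ('a \<Rightarrow> ereal) \<Rightarrow> ('a \<Rightarrow> real) \<Rightarrow> ennreal"
  where "vexp_modular_bar M p x =
    (\<integral>\<^sup>+ t. ennreal (1 / real_of_ereal (p t) * \<bar>x t\<bar> powr real_of_ereal (p t)) \<partial>M)"

definition vexp_space :: "'a measure \<Rightarrow> ('a \<Rightarrow> ereal) \<Rightarrow> ('a \<Rightarrow> real) set"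
  where "vexp_space M p =
    {x \<in> borel_measurable M. \<exists>l>0. vexp_modular M p (\<lambda>t. x t / l) \<le> 1}"

definition vexp_norm :: "'a measure \<Rightarrow> ('a \<Rightarrow> ereal) \<Rightarrow> ('a \<Rightarrow> real) \<Rightarrow> real"
  where "vexp_norm M p x = Inf {l. 0 < l \<and> vexp_modular M p (\<lambda>t. x t / l) \<le> 1}"

definition vexp_dual :: "'a measure \<Rightarrow> ('a \<Rightarrow> ereal) \<Rightarrow> (('a \<Rightarrow> real) \<Rightarrow> real) set"
  where "vexp_dual M p = {\<xi>.
    (\<forall>x\<in>vexp_space M p. \<forall>y\<in>vexp_space M p. \<xi> (\<lambda>t. x t + y t) = \<xi> x + \<xi> y) \<and>
    (\<forall>c. \<forall>x\<in>vexp_space M p. \<xi> (\<lambda>t. c * x t) = c * \<xi> x) \<and>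
    (\<exists>C. \<forall>x\<in>vexp_space M p. \<bar>\<xi> x\<bar> \<le> C * vexp_norm M p x)}"

definition vexp_dual_norm :: "'a measure \<Rightarrow> ('a \<Rightarrow> ereal) \<Rightarrow> (('a \<Rightarrow> real) \<Rightarrow> real) \<Rightarrow> real"
  where "vexp_dual_norm M p \<xi> =
    Sup {\<bar>\<xi> x\<bar> | x. x \<in> vexp_space M p \<and> vexp_norm M p x \<le> 1}"

text \<open>Functionals from the space (of classes) to \<open>\<real> \<union> {+\<infinity>}\<close>.\<close>

definition ext_functional :: "'a measure \<Rightarrow> ('a \<Rightarrow> ereal) \<Rightarrow> (('a \<Rightarrow> real) \<Rightarrow> ereal) \<Rightarrow> bool"
  where "ext_functional M p F \<longleftrightarrow>
    (\<forall>x\<in>vexp_space M p. F x \<noteq> -\<infinity>) \<and>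
    (\<forall>x\<in>vexp_space M p. \<forall>y\<in>vexp_space M p. (AE t in M. x t = y t) \<longrightarrow> F x = F y)"

definition proper_functional :: "'a measure \<Rightarrow> ('a \<Rightarrow> ereal) \<Rightarrow> (('a \<Rightarrow> real) \<Rightarrow> ereal) \<Rightarrow> bool"
  where "proper_functional M p F \<longleftrightarrow>
    ext_functional M p F \<and> (\<exists>x\<in>vexp_space M p. F x \<noteq> \<infinity>)"

definition convex_functional :: "'a measure \<Rightarrow> ('a \<Rightarrow> ereal) \<Rightarrow> (('a \<Rightarrow> real) \<Rightarrow> ereal) \<Rightarrow> bool"
  where "convex_functional M p F \<longleftrightarrow>
    (\<forall>x\<in>vexp_space M p. \<forall>y\<in>vexp_space M p. \<forall>s::real. 0 < s \<and> s < 1 \<longrightarrow>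
      F (\<lambda>t. s * x t + (1 - s) * y t) \<le> ereal s * F x + ereal (1 - s) * F y)"

definition lsc_functional :: "'a measure \<Rightarrow> ('a \<Rightarrow> ereal) \<Rightarrow> (('a \<Rightarrow> real) \<Rightarrow> ereal) \<Rightarrow> bool"
  where "lsc_functional M p F \<longleftrightarrow>
    (\<forall>x\<in>vexp_space M p. \<forall>c<F x. \<exists>e>0. \<forall>y\<in>vexp_space M p.
      vexp_norm M p (\<lambda>t. y t - x t) < e \<longrightarrow> c < F y)"

text \<open>
  Since the gradient is a map on the whole space, a functional with a gradient is finite everywhere.
\<close>

definition has_gateaux_gradient ::
  "'a measure \<Rightarrow> ('a \<Rightarrow> ereal) \<Rightarrow> (('a \<Rightarrow> real) \<Rightarrow> ereal) \<Rightarrow>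
    (('a \<Rightarrow> real) \<Rightarrow> (('a \<Rightarrow> real) \<Rightarrow> real)) \<Rightarrow> bool"
  where "has_gateaux_gradient M p F G \<longleftrightarrow>
    (\<forall>u\<in>vexp_space M p. \<bar>F u\<bar> \<noteq> \<infinity> \<and> G u \<in> vexp_dual M p \<and>
      (\<forall>v\<in>vexp_space M p.
        ((\<lambda>s::real. (F (\<lambda>t. u t + s * v t) - F u) / ereal s) \<longlongrightarrow> ereal (G u v)) (at 0)))"

text \<open>
  Sequences generated by the modular-proximal gradient algorithm with accepted step sizes \<open>\<tau>\<close>.
  The backtracking loop enters through its exit condition.
\<close>

definition mpg_sequence ::
  "'a measure \<Rightarrow> ('a \<Rightarrow> ereal) \<Rightarrow> (('a \<Rightarrow> real) \<Rightarrow> (('a \<Rightarrow> real) \<Rightarrow> real)) \<Rightarrow>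
    (('a \<Rightarrow> real) \<Rightarrow> ereal) \<Rightarrow> (nat \<Rightarrow> real) \<Rightarrow> (nat \<Rightarrow> 'a \<Rightarrow> real) \<Rightarrow> bool"
  where "mpg_sequence M p G g \<tau> x \<longleftrightarrow>
    x 0 \<in> vexp_space M p \<and>
    (\<forall>k. is_arg_min
           (\<lambda>y. enn2ereal (vexp_modular_bar M p (\<lambda>t. y t - x k t))
                + ereal (\<tau> k * G (x k) y) + ereal (\<tau> k) * g y)
           (\<lambda>y. y \<in> vexp_space M p) (x (Suc k))) \<and>
    (\<forall>k. vexp_modular M p (\<lambda>t. x k t - x (Suc k) t) < 1)"

end

theory Submission
  imports Defs
begin

text \<open>
  Write \<open>u = x k\<close>, \<open>v = x (k + 1)\<close>, \<open>d = v - u\<close>. Because \<open>norm d \<le> 1\<close> and \<open>p \<le> q\<close>, the Hoelder bound on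
  the gradient gives a descent inequality with error \<open>(K / q) \<rho>(d)\<close>, so the optimality condition at
  \<open>v\<close> in direction \<open>u - v\<close> yields \<open>\<delta> \<rho>(d) \<le> \<tau> (\<phi> u - \<phi> v)\<close>. Comparing \<open>v\<close> with \<open>u + s (w - u)\<close>, \<open>w\<close> a
  minimiser, whose proximal cost is at most \<open>s\<^sup>a \<rho>(w - u)\<close> with \<open>a = p\<^sub>-\<close>, gives for all \<open>s\<close> in \<open>(0,1)\<close>
  \<open>r (k + 1) \<le> (1 - \<delta> s) r k + C s\<^sup>a\<close>, and \<open>s = 2 / (\<delta> k)\<close> gives the rate by induction.
\<close>

section \<open>Scalar inequalities and the rate of a scalar recursion\<close>

text \<open>Since \<open>e - 1\<close> lies in [0, 1], Young's inequality against 1 bounds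
  \<open>(1 - s) powr (e - 1)\<close> by its tangent line at \<open>s = 0\<close>; multiplying by
  \<open>1 - s\<close> gives a bound that is exact to first order in \<open>s\<close>.\<close>

lemma one_minus_powr_le:
  fixes s e :: real
  assumes "0 < s" "s < 1" "1 \<le> e" "e \<le> 2"
  shows "(1 - s) powr e \<le> 1 - e * s + (e - 1) * s\<^sup>2"
proof -
  have "(1 - s) powr (e - 1) * 1 powr (2 - e) \<le> (e - 1) * (1 - s) + (2 - e) * 1"
    using assms by (intro Youngs_inequality_0) auto
  then have "(1 - s) powr (e - 1) \<le> 1 - (e - 1) * s"
    by (simp add: algebra_simps)
  then have "(1 - s) * (1 - s) powr (e - 1) \<le> (1 - s) * (1 - (e - 1) * s)"
    using assms by (intro mult_left_mono) auto
  moreover have "(1 - s) * (1 - s) powr (e - 1) = (1 - s) powr e"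
    using assms by (simp add: powr_mult_base)
  ultimately show ?thesis by (simp add: algebra_simps power2_eq_square)
qed

text \<open>The ratio of the two powers is \<open>exp ((1 - m) * ln (1 + 1 / k))\<close>; the bounds
  \<open>ln (1 + t) \<le> t\<close> and \<open>1 + t \<le> exp t\<close> estimate it from below.
  This measures how much the target rate drops from \<open>k\<close> to
  \<open>k + 1\<close>.\<close>

lemma powr_minus_one_step:
  fixes m :: real and k :: nat
  assumes "1 \<le> m" "k \<ge> 1"
  shows "(1 - (m - 1) / k) * real k powr (1 - m) \<le> real (Suc k) powr (1 - m)"
proof -
  have "1 - (m - 1) / k \<le> 1 + (1 - m) * ln (1 + 1 / k)"
  proof -
    have "ln (1 + 1 / real k) \<le> 1 / k" by (rule ln_add_one_self_le_self) simp
    then have "(m - 1) * ln (1 + 1 / real k) \<le> (m - 1) * (1 / k)"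
      using assms by (intro mult_left_mono) auto
    then show ?thesis by (simp add: algebra_simps)
  qed
  also have "\<dots> \<le> exp ((1 - m) * ln (1 + 1 / k))" by (rule exp_ge_add_one_self)
  also have "\<dots> = (1 + 1 / k) powr (1 - m)"
    using add_pos_nonneg[of 1 "1 / real k"] by (simp add: powr_def)
  finally have "(1 - (m - 1) / k) * real k powr (1 - m)
      \<le> (1 + 1 / k) powr (1 - m) * real k powr (1 - m)"
    by (intro mult_right_mono) auto
  also have "\<dots> = ((1 + 1 / k) * k) powr (1 - m)" by (simp add: powr_mult)
  also have "(1 + 1 / k) * k = Suc k" using assms by (simp add: field_simps)
  finally show ?thesis .
qed

text \<open>Taking \<open>s = 2 / (\<alpha> k)\<close> makes the linear gain \<open>2 \<eta> / k\<^sup>m\<close> beat both the error term and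
  the loss \<open>(m - 1) \<eta> / k\<^sup>m\<close> from passing from \<open>k\<close> to \<open>k + 1\<close>.\<close>

lemma sublinear_rate:
  fixes r :: "nat \<Rightarrow> real" and \<alpha> C m :: real
  assumes m: "1 < m" "m \<le> 2" and \<alpha>: "0 < \<alpha>" "\<alpha> \<le> 1" and C: "0 \<le> C"
    and mono: "\<And>k. k \<ge> 1 \<Longrightarrow> r (Suc k) \<le> r k"
    and step: "\<And>k s. k \<ge> 1 \<Longrightarrow> 0 < s \<Longrightarrow> s < 1 \<Longrightarrow>
      r (Suc k) \<le> (1 - \<alpha> * s) * r k + C * s powr m"
  shows "\<exists>\<eta>>0. \<forall>k\<ge>1. r k \<le> \<eta> * (1 / real k powr (m - 1))"
proof -
  define b where "b = 2 / \<alpha>"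
  \<comment> \<open>\<open>C * b powr m\<close> absorbs the error term once \<open>n > b\<close>,
    \<open>2 * b * r 1\<close> covers the indices up to \<open>b\<close>, and 1 keeps
    \<open>\<eta>\<close> positive, as \<open>r\<close> is not assumed nonnegative.\<close>
  define \<eta> where "\<eta> = max (max 1 (C * b powr m)) (2 * b * r 1)"
  have b: "b \<ge> 2" using \<alpha> by (simp add: b_def field_simps)
  have \<eta>: "\<eta> \<ge> 1" "\<eta> \<ge> C * b powr m" "\<eta> \<ge> 2 * b * r 1" by (auto simp: \<eta>_def)
  have inv: "1 / real k powr (m - 1) = real k powr (1 - m)" for k
    using powr_minus_divide[of "real k" "m - 1"] by simp
  have r1: "r k \<le> r 1" if "k \<ge> 1" for k
    using that
  proof (induction k rule: dec_induct)
    case (step n)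
    then show ?case using mono[of n] by linarith
  qed simp
  have "r k \<le> \<eta> * real k powr (1 - m)" if "k \<ge> 1" for k
    using that
  proof (induction k rule: dec_induct)
    case base
    have "r 1 \<le> \<eta>"
    proof (cases "r 1 \<ge> 0")
      case True
      then have "1 * r 1 \<le> 2 * b * r 1" using b by (intro mult_right_mono) auto
      then show ?thesis using \<eta> by linarith
    qed (use \<eta> in linarith)
    then show ?case by simp
  next
    case (step n)
    note n = \<open>1 \<le> n\<close>
    show ?case
    proof (cases "real n > b")
      case False
      \<comment> \<open>Here \<open>b / n \<ge> 1\<close> is not an admissible \<open>s\<close>.
        Monotonicity bounds \<open>r (Suc n)\<close> by \<open>r 1\<close>, and
        \<open>m \<le> 2\<close> keeps the target above \<open>\<eta> / (2 * b)\<close>.\<close>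
      have "1 / (2 * b) \<le> 1 / real (Suc n)"
        using False b n by (intro divide_left_mono) auto
      also have "\<dots> = real (Suc n) powr (-1)"
        by (simp add: powr_minus_divide)
      also have "\<dots> \<le> real (Suc n) powr (1 - m)" using m by (intro powr_mono) auto
      finally have "\<eta> * (1 / (2 * b)) \<le> \<eta> * real (Suc n) powr (1 - m)"
        using \<eta> by (intro mult_left_mono) auto
      moreover have "r 1 \<le> \<eta> * (1 / (2 * b))"
        using \<eta>(3) b by (simp add: field_simps)
      moreover have "r (Suc n) \<le> r 1" by (rule r1) simp
      ultimately show ?thesis by linarith
    next
      case True
      define P where "P = real n powr (1 - m)"
      have P: "P \<ge> 0" by (simp add: P_def)
      have pw: "real n powr (-m) = P / n"
        using n powr_add[of "real n" "1 - m" "-1"] by (simp add: P_def powr_minus_divide)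
      have s: "0 < b / n" "b / n < 1" using True b by auto
      have ab: "\<alpha> * (b / n) = 2 / n" using \<alpha> by (simp add: b_def)
      have "r (Suc n) \<le> (1 - 2 / n) * r n + C * (b / n) powr m"
        using assms(7)[OF n s] unfolding ab .
      moreover have "C * (b / n) powr m = (C * b powr m) * (P / n)"
        using b by (simp add: powr_divide powr_minus_divide flip: pw)
      moreover have "(C * b powr m) * (P / n) \<le> \<eta> * (P / n)"
        using \<eta> P by (intro mult_right_mono) auto
      \<comment> \<open>The induction hypothesis may be multiplied by \<open>1 - 2 / n\<close>
        because \<open>n > b \<ge> 2\<close>; the bound \<open>b \<ge> 2\<close> comes from
        \<open>\<alpha> \<le> 1\<close>.\<close>
      moreover have "(1 - 2 / n) * r n \<le> (1 - 2 / n) * (\<eta> * P)"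
        using step.IH True b unfolding P_def by (intro mult_left_mono) auto
      ultimately have "r (Suc n) \<le> (1 - 2 / n) * (\<eta> * P) + \<eta> * (P / n)" by linarith
      also have "\<dots> = \<eta> * ((1 - 1 / n) * P)" by (simp add: field_simps)
      also have "\<dots> \<le> \<eta> * ((1 - (m - 1) / n) * P)"
        using \<eta> P m n by (intro mult_left_mono mult_right_mono) (auto simp: field_simps)
      also have "\<dots> \<le> \<eta> * real (Suc n) powr (1 - m)"
        using powr_minus_one_step[of m n] m n \<eta> unfolding P_def by (intro mult_left_mono) auto
      finally show ?thesis .
    qed
  qed
  then show ?thesis using \<eta>(1) inv by (intro exI[of _ \<eta>]) auto
qed

section \<open>The variable exponent space and its modulars\<close>

text \<open>Real a.e. bounds on the exponent make \<open>real_of_ereal (p t)\<close> faithful a.e.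
  and reduce estimates of modulars to pointwise ones with constants independent of
  \<open>t\<close>.\<close>

locale variable_exponent =
  fixes M :: "'a measure" and p :: "'a \<Rightarrow> ereal" and a b :: real
  assumes exponent_measurable [measurable]: "p \<in> borel_measurable M"
    and exponent_bounds: "AE t in M. ereal a \<le> p t \<and> p t \<le> ereal b"
    and bounds: "1 \<le> a" "a \<le> b"
begin

abbreviation e :: "'a \<Rightarrow> real"
  where "e t \<equiv> real_of_ereal (p t)"

abbreviation L :: "('a \<Rightarrow> real) set"
  where "L \<equiv> vexp_space M p"

abbreviation norm_L :: "('a \<Rightarrow> real) \<Rightarrow> real"
  where "norm_L \<equiv> vexp_norm M p"

text \<open>On \<open>L\<close> this is the real value of \<open>vexp_modular\<close>, by
  \<open>modular_eq\<close>; where the integrand is not integrable, the Bochner integral takes the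
  default value 0.\<close>

definition modular :: "('a \<Rightarrow> real) \<Rightarrow> real"
  where "modular x = (\<integral>t. \<bar>x t\<bar> powr e t \<partial>M)"

definition modular_bar :: "('a \<Rightarrow> real) \<Rightarrow> real"
  where "modular_bar x = (\<integral>t. 1 / e t * \<bar>x t\<bar> powr e t \<partial>M)"

lemma AE_exponent: "AE t in M. a \<le> e t \<and> e t \<le> b"
  using exponent_bounds
proof eventually_elim
  case (elim t)
  then show ?case by (cases "p t") auto
qed

text \<open>A doubling condition uniform in the exponent: \<open>max 1\<close> makes one constant
  serve for small and large \<open>c\<close>, by monotonicity first in the base and then in the
  exponent.\<close>

lemma powr_cmult_le:
  assumes "a \<le> r" "r \<le> b"
  shows "\<bar>c * y\<bar> powr r \<le> max 1 \<bar>c\<bar> powr b * \<bar>y\<bar> powr r"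
proof -
  have "\<bar>c\<bar> powr r \<le> max 1 \<bar>c\<bar> powr r" using assms bounds by (intro powr_mono2) auto
  also have "\<dots> \<le> max 1 \<bar>c\<bar> powr b" using assms by (intro powr_mono) auto
  finally show ?thesis by (simp add: abs_mult powr_mult mult_right_mono)
qed

lemma integrable_cmult_powr:
  assumes [measurable]: "x \<in> borel_measurable M"
    and "integrable M (\<lambda>t. \<bar>x t\<bar> powr e t)"
  shows "integrable M (\<lambda>t. \<bar>c * x t\<bar> powr e t)"
proof (rule Bochner_Integration.integrable_bound)
  show "integrable M (\<lambda>t. max 1 \<bar>c\<bar> powr b * \<bar>x t\<bar> powr e t)" using assms by simp
  show "AE t in M. norm (\<bar>c * x t\<bar> powr e t) \<le> norm (max 1 \<bar>c\<bar> powr b * \<bar>x t\<bar> powr e t)"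
    using AE_exponent by eventually_elim (use powr_cmult_le in auto)
qed measurable

text \<open>With bounded exponents, a finite modular at one scale is finite at every scale.
  Conversely, \<open>e t \<ge> 1\<close> gives \<open>l \<le> l powr e t\<close> for
  \<open>l \<ge> 1\<close>, so dividing by an \<open>l\<close> above the modular brings it below
  1.\<close>

lemma space_iff:
  "x \<in> L \<longleftrightarrow> x \<in> borel_measurable M \<and> integrable M (\<lambda>t. \<bar>x t\<bar> powr e t)"
proof
  assume "x \<in> L"
  then obtain l where [measurable]: "x \<in> borel_measurable M" and l: "l > 0"
    and le: "vexp_modular M p (\<lambda>t. x t / l) \<le> 1"
    unfolding vexp_space_def by auto
  have "integrable M (\<lambda>t. \<bar>x t / l\<bar> powr e t)"
    using le unfolding vexp_modular_def
    by (intro integrableI_nonneg) (auto intro: le_less_trans)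
  from integrable_cmult_powr[OF _ this, of l] show
    "x \<in> borel_measurable M \<and> integrable M (\<lambda>t. \<bar>x t\<bar> powr e t)"
    using l by simp
next
  assume asm: "x \<in> borel_measurable M \<and> integrable M (\<lambda>t. \<bar>x t\<bar> powr e t)"
  then have [measurable]: "x \<in> borel_measurable M" by simp
  define l where "l = max 1 (\<integral>t. \<bar>x t\<bar> powr e t \<partial>M)"
  have l: "l \<ge> 1" "(\<integral>t. \<bar>x t\<bar> powr e t \<partial>M) \<le> l" by (auto simp: l_def)
  have "vexp_modular M p (\<lambda>t. x t / l) \<le> (\<integral>\<^sup>+ t. ennreal (\<bar>x t\<bar> powr e t / l) \<partial>M)"
    unfolding vexp_modular_def
  proof (rule nn_integral_mono_AE)
    show "AE t in M. ennreal (\<bar>x t / l\<bar> powr e t) \<le> ennreal (\<bar>x t\<bar> powr e t / l)"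
      using AE_exponent
    proof eventually_elim
      case (elim t)
      have "l powr 1 \<le> l powr e t" using l elim bounds by (intro powr_mono) auto
      then show ?case
        using l by (auto simp: powr_divide intro!: ennreal_leI divide_left_mono)
    qed
  qed
  also have "\<dots> = ennreal (\<integral>t. \<bar>x t\<bar> powr e t / l \<partial>M)"
    using asm l by (intro nn_integral_eq_integral) auto
  also have "\<dots> \<le> 1" using l by simp
  finally show "x \<in> L" using l unfolding vexp_space_def by (auto intro!: exI[of _ l])
qed

lemma space_measurable [measurable_dest]: "x \<in> L \<Longrightarrow> x \<in> borel_measurable M"
  by (simp add: space_iff)

lemma space_integrable: "x \<in> L \<Longrightarrow> integrable M (\<lambda>t. \<bar>x t\<bar> powr e t)"
  by (simp add: space_iff)

lemma space_cmult: "x \<in> L \<Longrightarrow> (\<lambda>t. c * x t) \<in> L"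
  by (auto simp: space_iff intro: integrable_cmult_powr)

lemma powr_add_le:
  assumes "a \<le> r" "r \<le> b"
  shows "\<bar>y + z\<bar> powr r \<le> 2 powr b * (\<bar>y\<bar> powr r + \<bar>z\<bar> powr r)"
proof -
  have "\<bar>y + z\<bar> powr r \<le> \<bar>2 * max \<bar>y\<bar> \<bar>z\<bar>\<bar> powr r"
    using assms bounds by (intro powr_mono2) auto
  also have "\<dots> \<le> 2 powr b * max \<bar>y\<bar> \<bar>z\<bar> powr r"
    using powr_cmult_le[OF assms, of 2 "max \<bar>y\<bar> \<bar>z\<bar>"] by simp
  also have "\<dots> \<le> 2 powr b * (\<bar>y\<bar> powr r + \<bar>z\<bar> powr r)"
    by (intro mult_left_mono) (auto simp: max_def)
  finally show ?thesis .
qed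

lemma space_add:
  assumes "x \<in> L" "y \<in> L"
  shows "(\<lambda>t. x t + y t) \<in> L"
  unfolding space_iff
proof
  note [measurable] = assms[THEN space_measurable]
  show "(\<lambda>t. x t + y t) \<in> borel_measurable M" by measurable
  show "integrable M (\<lambda>t. \<bar>x t + y t\<bar> powr e t)"
  proof (rule Bochner_Integration.integrable_bound)
    show "integrable M (\<lambda>t. 2 powr b * (\<bar>x t\<bar> powr e t + \<bar>y t\<bar> powr e t))"
      using assms by (simp add: space_integrable)
    show "AE t in M. norm (\<bar>x t + y t\<bar> powr e t)
        \<le> norm (2 powr b * (\<bar>x t\<bar> powr e t + \<bar>y t\<bar> powr e t))"
      using AE_exponent by eventually_elim (use powr_add_le in auto)
  qed measurable
qed

lemma space_diff: "x \<in> L \<Longrightarrow> y \<in> L \<Longrightarrow> (\<lambda>t. x t - y t) \<in> L"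
  using space_add[of x "\<lambda>t. -1 * y t"] space_cmult[of y "-1"] by simp

lemma space_comb: "x \<in> L \<Longrightarrow> y \<in> L \<Longrightarrow> (\<lambda>t. c * x t + d * y t) \<in> L"
  by (intro space_add space_cmult)

lemma modular_eq: "x \<in> L \<Longrightarrow> vexp_modular M p x = ennreal (modular x)"
  unfolding vexp_modular_def modular_def
  by (intro nn_integral_eq_integral space_integrable) auto

lemma modular_nonneg: "0 \<le> modular x"
  unfolding modular_def by simp

lemma modular_bar_integrable:
  assumes "x \<in> L"
  shows "integrable M (\<lambda>t. 1 / e t * \<bar>x t\<bar> powr e t)"
proof (rule Bochner_Integration.integrable_bound[OF space_integrable[OF assms]])
  note [measurable] = space_measurable[OF assms]
  show "(\<lambda>t. 1 / e t * \<bar>x t\<bar> powr e t) \<in> borel_measurable M" by measurable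
  show "AE t in M. norm (1 / e t * \<bar>x t\<bar> powr e t) \<le> norm (\<bar>x t\<bar> powr e t)"
    using AE_exponent
  proof eventually_elim
    case (elim t)
    then have 0: "0 \<le> 1 / e t" "1 / e t \<le> 1" using bounds by auto
    have "norm (1 / e t * \<bar>x t\<bar> powr e t) = 1 / e t * \<bar>x t\<bar> powr e t"
      unfolding real_norm_def by (intro abs_of_nonneg mult_nonneg_nonneg 0) auto
    also have "\<dots> \<le> 1 * \<bar>x t\<bar> powr e t" using 0 by (intro mult_right_mono) auto
    also have "\<dots> \<le> norm (\<bar>x t\<bar> powr e t)" by simp
    finally show ?case .
  qed
qed

lemma modular_bar_eq:
  assumes "x \<in> L"
  shows "vexp_modular_bar M p x = ennreal (modular_bar x)"
  unfolding vexp_modular_bar_def modular_bar_def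
proof (rule nn_integral_eq_integral[OF modular_bar_integrable[OF assms]])
  show "AE t in M. 0 \<le> 1 / e t * \<bar>x t\<bar> powr e t"
    using AE_exponent by eventually_elim (use bounds in auto)
qed

lemma modular_bar_nonneg: "0 \<le> modular_bar x"
  unfolding modular_bar_def
proof (rule integral_nonneg_AE)
  show "AE t in M. 0 \<le> 1 / e t * \<bar>x t\<bar> powr e t"
    using AE_exponent by eventually_elim (use bounds in auto)
qed

text \<open>For \<open>s < 1\<close> the smallest exponent dominates, so
  \<open>s powr e t \<le> s powr a\<close>. This is where the lower exponent bound enters the
  rate.\<close>

lemma modular_bar_cmult_le:
  assumes "x \<in> L" "0 < s" "s < 1"
  shows "modular_bar (\<lambda>t. s * x t) \<le> s powr a * modular x"
proof -
  have "modular_bar (\<lambda>t. s * x t) \<le> (\<integral>t. s powr a * \<bar>x t\<bar> powr e t \<partial>M)"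
    unfolding modular_bar_def
  proof (rule integral_mono_AE)
    show "integrable M (\<lambda>t. 1 / e t * \<bar>s * x t\<bar> powr e t)"
      using assms by (intro modular_bar_integrable space_cmult)
    show "integrable M (\<lambda>t. s powr a * \<bar>x t\<bar> powr e t)"
      using assms by (simp add: space_integrable)
    show "AE t in M. 1 / e t * \<bar>s * x t\<bar> powr e t \<le> s powr a * \<bar>x t\<bar> powr e t"
      using AE_exponent
    proof eventually_elim
      case (elim t)
      have "1 / e t * \<bar>s * x t\<bar> powr e t \<le> 1 * \<bar>s * x t\<bar> powr e t"
        using elim bounds by (intro mult_right_mono) auto
      also have "\<dots> = s powr e t * \<bar>x t\<bar> powr e t"
        using assms by (simp add: abs_mult powr_mult)
      also have "\<dots> \<le> s powr a * \<bar>x t\<bar> powr e t"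
        using assms elim by (intro mult_right_mono powr_mono') auto
      finally show ?case .
    qed
  qed
  then show ?thesis by (simp add: modular_def)
qed

text \<open>The weight \<open>1 / e t\<close> cancels the factor \<open>e t\<close> of the
  derivative, so the slope of \<open>modular_bar\<close> when shrinking \<open>x\<close> is
  \<open>- modular x\<close>. The explicit quadratic remainder replaces a limit under the
  integral.\<close>

lemma modular_bar_shrink_le:
  assumes "x \<in> L" "0 < s" "s < 1" "b \<le> 2"
  shows "modular_bar (\<lambda>t. (1 - s) * x t) \<le> modular_bar x - s * modular x + s\<^sup>2 * modular x"
proof -
  have "modular_bar (\<lambda>t. (1 - s) * x t)
      \<le> (\<integral>t. 1 / e t * \<bar>x t\<bar> powr e t + (s\<^sup>2 - s) * \<bar>x t\<bar> powr e t \<partial>M)"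
    unfolding modular_bar_def
  proof (rule integral_mono_AE)
    show "integrable M (\<lambda>t. 1 / e t * \<bar>(1 - s) * x t\<bar> powr e t)"
      using assms by (intro modular_bar_integrable space_cmult)
    show "integrable M (\<lambda>t. 1 / e t * \<bar>x t\<bar> powr e t + (s\<^sup>2 - s) * \<bar>x t\<bar> powr e t)"
      using assms by (intro Bochner_Integration.integrable_add modular_bar_integrable) (simp_all add: space_integrable)
    show "AE t in M. 1 / e t * \<bar>(1 - s) * x t\<bar> powr e t
        \<le> 1 / e t * \<bar>x t\<bar> powr e t + (s\<^sup>2 - s) * \<bar>x t\<bar> powr e t"
      using AE_exponent
    proof eventually_elim
      case (elim t)
      then have e: "1 \<le> e t" "e t \<le> 2" using bounds assms by auto
      have "(1 - s) powr e t \<le> 1 - e t * s + (e t - 1) * s\<^sup>2"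
        by (rule one_minus_powr_le) (use assms e in auto)
      also have "\<dots> \<le> 1 - e t * s + e t * s\<^sup>2" by (simp add: algebra_simps)
      finally have "1 / e t * (1 - s) powr e t \<le> 1 / e t * (1 - e t * s + e t * s\<^sup>2)"
        using e by (intro mult_left_mono) auto
      also have "\<dots> = 1 / e t + (s\<^sup>2 - s)" using e by (simp add: field_simps)
      finally have "1 / e t * (1 - s) powr e t * \<bar>x t\<bar> powr e t
          \<le> (1 / e t + (s\<^sup>2 - s)) * \<bar>x t\<bar> powr e t"
        by (intro mult_right_mono) auto
      moreover have "\<bar>(1 - s) * x t\<bar> powr e t = (1 - s) powr e t * \<bar>x t\<bar> powr e t"
        using assms by (simp add: abs_mult powr_mult)
      ultimately show ?case by (simp add: distrib_right)
    qed
  qed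
  also have "\<dots> = modular_bar x + (s\<^sup>2 - s) * modular x"
    using modular_bar_integrable[OF assms(1)] space_integrable[OF assms(1)] by (simp add: modular_def modular_bar_def)
  finally show ?thesis by (simp add: algebra_simps)
qed

lemma modular_diff_le:
  assumes "x \<in> L" "y \<in> L"
  shows "modular (\<lambda>t. x t - y t) \<le> 2 powr b * (modular x + modular y)"
proof -
  have "modular (\<lambda>t. x t - y t) \<le> (\<integral>t. 2 powr b * (\<bar>x t\<bar> powr e t + \<bar>y t\<bar> powr e t) \<partial>M)"
    unfolding modular_def
  proof (rule integral_mono_AE)
    show "AE t in M. \<bar>x t - y t\<bar> powr e t \<le> 2 powr b * (\<bar>x t\<bar> powr e t + \<bar>y t\<bar> powr e t)"
      using AE_exponent
    proof eventually_elim
      case (elim t)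
      then show ?case using powr_add_le[of "e t" "x t" "- y t"] by simp
    qed
    show "integrable M (\<lambda>t. \<bar>x t - y t\<bar> powr e t)"
      using assms by (intro space_integrable space_diff)
  qed (use assms in \<open>simp add: space_integrable\<close>)
  then show ?thesis using assms by (simp add: modular_def space_integrable)
qed

section \<open>The Luxemburg norm compared with the modular\<close>

lemma norm_le:
  assumes "0 < l" "vexp_modular M p (\<lambda>t. x t / l) \<le> 1"
  shows "norm_L x \<le> l"
  unfolding vexp_norm_def
  by (rule cInf_lower) (use assms in \<open>auto intro!: bdd_belowI[of _ 0]\<close>)

lemma le_norm:
  assumes "x \<in> L" "\<And>l. 0 < l \<Longrightarrow> vexp_modular M p (\<lambda>t. x t / l) \<le> 1 \<Longrightarrow> c \<le> l"
  shows "c \<le> norm_L x"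
  unfolding vexp_norm_def
  by (rule cInf_greatest) (use assms in \<open>auto simp: vexp_space_def\<close>)

lemma norm_nonneg: "x \<in> L \<Longrightarrow> 0 \<le> norm_L x"
  by (rule le_norm) auto

lemma norm_cmult_le:
  assumes x: "x \<in> L" and s: "0 < s"
  shows "norm_L (\<lambda>t. s * x t) \<le> s * norm_L x"
proof -
  have "norm_L (\<lambda>t. s * x t) / s \<le> norm_L x"
  proof (rule le_norm[OF x])
    fix l assume "0 < l" "vexp_modular M p (\<lambda>t. x t / l) \<le> 1"
    then have "norm_L (\<lambda>t. s * x t) \<le> s * l"
      using s by (intro norm_le) auto
    then show "norm_L (\<lambda>t. s * x t) / s \<le> l" using s by (simp add: field_simps)
  qed
  then show ?thesis using s by (simp add: field_simps)
qed

lemma modular_cmult_le: 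
  assumes "x \<in> L" 
  shows "modular (\<lambda>t. c * x t) \<le> max 1 \<bar>c\<bar> powr b * modular x"
proof -
  have "modular (\<lambda>t. c * x t) \<le> (\<integral>t. max 1 \<bar>c\<bar> powr b * \<bar>x t\<bar> powr e t \<partial>M)"
    unfolding modular_def
  proof (rule integral_mono_AE)
    show "AE t in M. \<bar>c * x t\<bar> powr e t \<le> max 1 \<bar>c\<bar> powr b * \<bar>x t\<bar> powr e t"
      using AE_exponent by eventually_elim (use powr_cmult_le in auto)
    show "integrable M (\<lambda>t. \<bar>c * x t\<bar> powr e t)"
      using assms by (intro space_integrable space_cmult)
  qed (use assms in \<open>simp add: space_integrable\<close>)
  then show ?thesis by (simp add: modular_def)
qed

text \<open>The strict inequality supplies an admissible scale \<open>l < B\<close> without the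
  infimum having to be attained; rescaling from \<open>x / l\<close> back to \<open>x\<close> costs
  at most \<open>max 1 B powr b\<close>.\<close>

lemma modular_le_of_norm_less:
  assumes x: "x \<in> L" and B: "norm_L x < B"
  shows "modular x \<le> max 1 B powr b"
proof -
  obtain l where l: "0 < l" "vexp_modular M p (\<lambda>t. x t / l) \<le> 1" "l < B"
    using le_norm[OF x, of B] B by force
  have y: "(\<lambda>t. x t / l) \<in> L" using space_cmult[OF x, of "1 / l"] by simp
  have 1: "modular (\<lambda>t. x t / l) \<le> 1" using l modular_eq[OF y] by simp
  have "modular x \<le> max 1 \<bar>l\<bar> powr b * modular (\<lambda>t. x t / l)"
    using modular_cmult_le[OF y, of l] l by simp
  also have "\<dots> \<le> max 1 B powr b * 1"
    using l 1 bounds modular_nonneg by (intro mult_mono powr_mono2) auto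
  finally show ?thesis by simp
qed

text \<open>For \<open>l \<le> 1\<close>, dividing by \<open>l\<close> enlarges the modular by at
  most \<open>(1 / l) powr b\<close>, so \<open>l = modular x powr (1 / b)\<close> is admissible. As
  this \<open>l\<close> is at most 1, raising the exponent from \<open>b\<close> to \<open>q\<close>
  only decreases its power.\<close>

lemma norm_powr_le_modular:
  assumes x: "x \<in> L" and le1: "modular x \<le> 1" and q: "b \<le> q"
  shows "norm_L x powr q \<le> modular x"
proof -
  have key: "norm_L x \<le> l" if l: "0 < l" "l \<le> 1" "modular x \<le> l powr b" for l
  proof (rule norm_le[OF l(1)])
    have y: "(\<lambda>t. x t / l) \<in> L" using space_cmult[OF x, of "1 / l"] by simp
    have "modular (\<lambda>t. x t / l) \<le> max 1 \<bar>1 / l\<bar> powr b * modular x"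
      using modular_cmult_le[OF x, of "1 / l"] by simp
    also have "max 1 \<bar>1 / l\<bar> = 1 / l" using l by simp
    also have "(1 / l) powr b * modular x \<le> 1"
      using l by (simp add: powr_divide divide_le_eq)
    finally show "vexp_modular M p (\<lambda>t. x t / l) \<le> 1" by (simp add: modular_eq[OF y])
  qed
  show ?thesis
  proof (cases "modular x = 0")
    \<comment> \<open>The choice of \<open>l\<close> above would be 0 and hence not a scale; instead
      every \<open>l\<close> in (0, 1] is admissible.\<close>
    case True
    have "norm_L x \<le> 0"
    proof (rule field_le_epsilon)
      fix \<epsilon> :: real assume "\<epsilon> > 0"
      then have "norm_L x \<le> min \<epsilon> 1" using True by (intro key) auto
      then show "norm_L x \<le> 0 + \<epsilon>" by simp
    qed
    then have "norm_L x = 0" using norm_nonneg[OF x] by simp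
    then show ?thesis using True by simp
  next
    case False
    then have pos: "modular x > 0" using modular_nonneg[of x] by simp
    define l where "l = modular x powr (1 / b)"
    have l: "0 < l" "l \<le> 1" using pos le1 bounds by (auto simp: l_def intro!: powr_le1)
    have lb: "l powr b = modular x" using pos bounds by (simp add: l_def powr_powr)
    have "norm_L x powr q \<le> l powr q"
      using key[of l] l lb norm_nonneg[OF x] q bounds by (intro powr_mono2) auto
    also have "\<dots> \<le> l powr b" using l q by (intro powr_mono') auto
    finally show ?thesis using lb by simp
  qed
qed


section \<open>Dual functionals and the dual norm\<close>

lemma zero_mem_space: "(\<lambda>t. 0) \<in> L"
  by (simp add: space_iff)

lemma dual_diff:
  assumes "\<xi> \<in> vexp_dual M p" "\<zeta> \<in> vexp_dual M p"
  shows "(\<lambda>w. \<xi> w - \<zeta> w) \<in> vexp_dual M p"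
proof -
  obtain C D where "\<forall>x\<in>L. \<bar>\<xi> x\<bar> \<le> C * norm_L x" "\<forall>x\<in>L. \<bar>\<zeta> x\<bar> \<le> D * norm_L x"
    using assms unfolding vexp_dual_def by blast
  then have "\<forall>x\<in>L. \<bar>\<xi> x - \<zeta> x\<bar> \<le> (C + D) * norm_L x"
    by (fastforce simp: distrib_right)
  then have "\<exists>C. \<forall>x\<in>L. \<bar>\<xi> x - \<zeta> x\<bar> \<le> C * norm_L x" by blast
  then show ?thesis
    using assms by (simp add: vexp_dual_def algebra_simps)
qed

lemma dual_add:
  "\<xi> \<in> vexp_dual M p \<Longrightarrow> x \<in> L \<Longrightarrow> y \<in> L \<Longrightarrow> \<xi> (\<lambda>t. x t + y t) = \<xi> x + \<xi> y"
  by (simp add: vexp_dual_def)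

lemma dual_cmult: "\<xi> \<in> vexp_dual M p \<Longrightarrow> x \<in> L \<Longrightarrow> \<xi> (\<lambda>t. c * x t) = c * \<xi> x"
  by (simp add: vexp_dual_def)

lemma dual_diff_arg:
  assumes "\<xi> \<in> vexp_dual M p" "x \<in> L" "y \<in> L"
  shows "\<xi> (\<lambda>t. x t - y t) = \<xi> x - \<xi> y"
proof -
  have "\<xi> x = \<xi> (\<lambda>t. (x t - y t) + y t)" by simp
  also have "\<dots> = \<xi> (\<lambda>t. x t - y t) + \<xi> y"
    by (rule dual_add) (use assms space_diff in auto)
  finally show ?thesis by simp
qed

lemma dual_comb:
  assumes "\<xi> \<in> vexp_dual M p" "x \<in> L" "y \<in> L"
  shows "\<xi> (\<lambda>t. c * x t + d * y t) = c * \<xi> x + d * \<xi> y"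
  using dual_add[OF assms(1) space_cmult[OF assms(2)] space_cmult[OF assms(3)]]
    dual_cmult[OF assms(1,2)] dual_cmult[OF assms(1,3)] by simp

text \<open>Normalising by admissible scales \<open>l\<close> instead of the norm avoids dividing by
  a norm that vanishes on a.e. zero functions; the infimum over \<open>l\<close> then gives the
  claim.\<close>

lemma dual_le:
  assumes \<xi>: "\<xi> \<in> vexp_dual M p" and x: "x \<in> L"
  shows "\<bar>\<xi> x\<bar> \<le> vexp_dual_norm M p \<xi> * norm_L x"
proof -
  let ?d = "vexp_dual_norm M p \<xi>"
  have hom: "\<xi> (\<lambda>t. c * y t) = c * \<xi> y" if "y \<in> L" for c y
    by (rule dual_cmult[OF \<xi> that])
  obtain C where C: "\<And>y. y \<in> L \<Longrightarrow> \<bar>\<xi> y\<bar> \<le> C * norm_L y"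
    using \<xi> unfolding vexp_dual_def by blast
  have bdd: "bdd_above {\<bar>\<xi> y\<bar> | y. y \<in> L \<and> norm_L y \<le> 1}"
  proof (rule bdd_aboveI[of _ "\<bar>C\<bar>"])
    fix z assume "z \<in> {\<bar>\<xi> y\<bar> | y. y \<in> L \<and> norm_L y \<le> 1}"
    then obtain y where y: "z = \<bar>\<xi> y\<bar>" "y \<in> L" "norm_L y \<le> 1" by auto
    have "C * norm_L y \<le> \<bar>C\<bar> * 1"
      using y norm_nonneg[of y] by (intro mult_mono) auto
    then show "z \<le> \<bar>C\<bar>" using C[of y] y by simp
  qed
  have d: "\<bar>\<xi> y\<bar> \<le> ?d" if "y \<in> L" "norm_L y \<le> 1" for y
    unfolding vexp_dual_norm_def using that by (intro cSup_upper bdd) auto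
  have le: "\<bar>\<xi> x\<bar> \<le> ?d * l" if l: "0 < l" "vexp_modular M p (\<lambda>t. x t / l) \<le> 1" for l
  proof -
    have y: "(\<lambda>t. x t / l) \<in> L" using space_cmult[OF x, of "1 / l"] by simp
    have "norm_L (\<lambda>t. x t / l) \<le> 1" by (rule norm_le) (use l in auto)
    from d[OF y this] have "\<bar>1 / l * \<xi> x\<bar> \<le> ?d"
      using hom[OF x, of "1 / l"] by simp
    then show ?thesis using l by (simp add: abs_mult field_simps)
  qed
  have d0: "?d \<ge> 0"
  proof -
    have "norm_L (\<lambda>t. 0) \<le> 1" by (rule norm_le) (auto simp: vexp_modular_def)
    from d[OF zero_mem_space this] show ?thesis by simp
  qed
  show ?thesis
  proof (cases "?d = 0")
    \<comment> \<open>Division by the dual norm is impossible here, but a single admissible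
      \<open>l\<close> already forces \<open>\<xi> x = 0\<close>.\<close>
    case True
    obtain l where "0 < l" "vexp_modular M p (\<lambda>t. x t / l) \<le> 1"
      using x unfolding vexp_space_def by auto
    from le[OF this] True show ?thesis by simp
  next
    case False
    have "\<bar>\<xi> x\<bar> / ?d \<le> norm_L x"
      by (rule le_norm[OF x]) (use le d0 False in \<open>simp add: field_simps\<close>)
    then show ?thesis using d0 False by (simp add: field_simps)
  qed
qed

section \<open>Gateaux differentiable functionals along line segments\<close>

lemma gateaux_finite: "has_gateaux_gradient M p f G \<Longrightarrow> u \<in> L \<Longrightarrow> f u = ereal (real_of_ereal (f u))"
  unfolding has_gateaux_gradient_def by (simp add: ereal_real)

lemma gateaux_dual: "has_gateaux_gradient M p f G \<Longrightarrow> u \<in> L \<Longrightarrow> G u \<in> vexp_dual M p"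
  unfolding has_gateaux_gradient_def by simp

text \<open>Moving the base point to \<open>u + c v\<close> turns the Gateaux limit at 0 into an
  ordinary derivative at \<open>c\<close>. The extended real and the real difference quotient need
  to agree only for nonzero increments.\<close>

lemma gateaux_deriv:
  assumes G: "has_gateaux_gradient M p f G" and u: "u \<in> L" and v: "v \<in> L"
  shows "((\<lambda>s. real_of_ereal (f (\<lambda>t. u t + s * v t))) has_real_derivative
    G (\<lambda>t. u t + c * v t) v) (at c)"
proof -
  define h where "h s = real_of_ereal (f (\<lambda>t. u t + s * v t))" for s
  define w where "w = (\<lambda>t. u t + c * v t)"
  have mem: "(\<lambda>t. u t + s * v t) \<in> L" for s using space_comb[OF u v, of 1 s] by simp
  have fh: "f (\<lambda>t. u t + s * v t) = ereal (h s)" for s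
    unfolding h_def by (rule gateaux_finite[OF G mem])
  have "w \<in> L" unfolding w_def by (rule mem)
  then have "((\<lambda>s. (f (\<lambda>t. w t + s * v t) - f w) / ereal s) \<longlongrightarrow> ereal (G w v)) (at 0)"
    using G v unfolding has_gateaux_gradient_def by blast
  moreover have "(\<lambda>t. w t + s * v t) = (\<lambda>t. u t + (c + s) * v t)" for s
    by (simp add: w_def fun_eq_iff algebra_simps)
  ultimately have "((\<lambda>s. (ereal (h (c + s)) - ereal (h c)) / ereal s) \<longlongrightarrow> ereal (G w v)) (at 0)"
    using fh w_def by simp
  then have "((\<lambda>s. ereal ((h (c + s) - h c) / s)) \<longlongrightarrow> ereal (G w v)) (at 0)"
    by (rule Lim_transform_eventually) (auto simp: eventually_at_filter)
  then show ?thesis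
    unfolding h_def[symmetric] w_def[symmetric] DERIV_def by (simp add: h_def)
qed

text \<open>By convexity the difference quotients along the segment from \<open>u\<close> to
  \<open>y\<close> are at most \<open>F y - F u\<close>; the bound passes to their limit from the
  right.\<close>

lemma gradient_inequality:
  assumes G: "has_gateaux_gradient M p f G" and f: "convex_functional M p f"
    and u: "u \<in> L" and y: "y \<in> L"
  shows "real_of_ereal (f u) + (G u y - G u u) \<le> real_of_ereal (f y)"
proof -
  define F where "F z = real_of_ereal (f z)" for z
  have fF: "f z = ereal (F z)" if "z \<in> L" for z
    unfolding F_def by (rule gateaux_finite[OF G that])
  define d where "d = (\<lambda>t. y t - u t)"
  have d: "d \<in> L" unfolding d_def by (rule space_diff[OF y u])
  define h where "h = (\<lambda>s. F (\<lambda>t. u t + s * d t))"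
  have h0: "h 0 = F u" by (simp add: h_def)
  have "(h has_real_derivative G u d) (at 0)"
    using gateaux_deriv[OF G u d, of 0] by (simp add: h_def F_def)
  then have lim: "((\<lambda>s. (h s - h 0) / s) \<longlongrightarrow> G u d) (at_right 0)"
    unfolding DERIV_def by (auto intro: tendsto_within_subset)
  have "\<forall>\<^sub>F s in at_right (0::real). s < 1"
    by (rule eventually_at_rightI[of 0 1]) auto
  then have "\<forall>\<^sub>F s in at_right 0. (h s - h 0) / s \<le> F y - F u"
    using eventually_at_right_less[of "0::real"]
  proof eventually_elim
    case (elim s)
    have "f (\<lambda>t. s * y t + (1 - s) * u t) \<le> ereal s * f y + ereal (1 - s) * f u"
      using f y u elim unfolding convex_functional_def by blast
    moreover have "(\<lambda>t. s * y t + (1 - s) * u t) = (\<lambda>t. u t + s * d t)"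
      by (simp add: d_def fun_eq_iff algebra_simps)
    moreover have "(\<lambda>t. u t + s * d t) \<in> L" using space_comb[OF u d, of 1 s] by simp
    ultimately have "h s \<le> s * F y + (1 - s) * F u"
      using fF u y by (simp add: h_def)
    then have "h s - h 0 \<le> (F y - F u) * s" by (simp add: h0 algebra_simps)
    then show ?case using elim by (simp add: pos_divide_le_eq)
  qed
  from tendsto_upperbound[OF lim this] have "G u d \<le> F y - F u" by simp
  moreover have "G u d = G u y - G u u"
    unfolding d_def by (rule dual_diff_arg[OF gateaux_dual[OF G u] y u])
  ultimately show ?thesis by (simp add: F_def)
qed

text \<open>The Hoelder bound controls the derivative of \<open>f\<close> along the segment by
  \<open>K * N powr q * s powr (q - 1)\<close> beyond its initial slope. Subtracting the
  antiderivative of this bound leaves a nonincreasing function \<open>\<psi>\<close>, which replaces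
  integration.\<close>

lemma hoelder_descent:
  assumes G: "has_gateaux_gradient M p f G" and K: "0 \<le> K"
    and hoelder: "\<And>u v. u \<in> L \<Longrightarrow> v \<in> L \<Longrightarrow>
      vexp_dual_norm M p (\<lambda>w. G u w - G v w) \<le> K * norm_L (\<lambda>t. u t - v t) powr (q - 1)"
    and q: "q \<ge> 1" and u: "u \<in> L" and v: "v \<in> L"
  shows "real_of_ereal (f v)
    \<le> real_of_ereal (f u) + (G u v - G u u) + K / q * norm_L (\<lambda>t. v t - u t) powr q"
proof -
  define d where "d = (\<lambda>t. v t - u t)"
  have d: "d \<in> L" unfolding d_def by (rule space_diff[OF v u])
  define N where "N = norm_L d"
  have N: "N \<ge> 0" unfolding N_def by (rule norm_nonneg[OF d])
  define h where "h = (\<lambda>s. real_of_ereal (f (\<lambda>t. u t + s * d t)))"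
  have h: "(h has_real_derivative G (\<lambda>t. u t + s * d t) d) (at s)" for s
    using gateaux_deriv[OF G u d, of s] by (simp add: h_def)
  define \<psi> where "\<psi> s = h s - s * G u d - K * N powr q / q * s powr q" for s
  have "\<psi> 1 \<le> \<psi> 0"
  \<comment> \<open>Derivatives are taken at interior points, where \<open>s powr q\<close> is
    differentiated with \<open>s > 0\<close>; continuity handles the endpoints.\<close>
  proof (rule DERIV_nonpos_imp_decreasing_open[where f = \<psi>])
    fix s :: real assume s: "0 < s" "s < 1"
    let ?w = "\<lambda>t. u t + s * d t"
    have w: "?w \<in> L" using space_comb[OF u d, of 1 s] by simp
    have "G ?w d - G u d \<le> vexp_dual_norm M p (\<lambda>z. G ?w z - G u z) * N"
      using dual_le[OF dual_diff[OF gateaux_dual[OF G w] gateaux_dual[OF G u]] d]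
      unfolding N_def by linarith
    also have "\<dots> \<le> K * norm_L (\<lambda>t. s * d t) powr (q - 1) * N"
      using hoelder[OF w u] N by (intro mult_right_mono) auto
    also have "\<dots> \<le> K * (s * N) powr (q - 1) * N"
      using norm_cmult_le[OF d s(1)] norm_nonneg[OF space_cmult[OF d, of s]] q K N
      unfolding N_def by (intro mult_left_mono mult_right_mono powr_mono2) auto
    also have "\<dots> = K * N powr q * s powr (q - 1)"
      using N s by (cases "N = 0") (auto simp: powr_mult powr_diff)
    finally have "G ?w d - G u d - K * N powr q * s powr (q - 1) \<le> 0" by simp
    moreover have "(\<psi> has_real_derivative
        G ?w d - G u d - K * N powr q / q * (q * s powr (q - 1))) (at s)"
      unfolding \<psi>_def using s by (auto intro!: derivative_eq_intros h)
    ultimately show "\<exists>y. (\<psi> has_real_derivative y) (at s) \<and> y \<le> 0"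
      using q by auto
  next
    have "continuous_on {0..1} h"
      using h by (meson DERIV_isCont continuous_at_imp_continuous_on)
    then show "continuous_on {0..1} \<psi>"
      unfolding \<psi>_def using q by (intro continuous_intros continuous_on_powr') auto
  qed simp
  moreover have "h 1 = real_of_ereal (f v)" "h 0 = real_of_ereal (f u)"
    by (simp_all add: h_def d_def)
  moreover have "G u d = G u v - G u u"
    unfolding d_def by (rule dual_diff_arg[OF gateaux_dual[OF G u] v u])
  ultimately show ?thesis using q by (simp add: \<psi>_def N_def d_def)
qed

end

section \<open>The composite problem and a single proximal step\<close>

text \<open>The functional \<open>\<xi>\<close> is the gradient frozen at \<open>u\<close>; the
  objective is spelled as in \<open>mpg_sequence\<close>.\<close>

definition prox_grad_step ::
    "(('a \<Rightarrow> real) \<Rightarrow> ereal) \<Rightarrow> (('a \<Rightarrow> real) \<Rightarrow> real) \<Rightarrow> real \<Rightarrow> 'a measure \<Rightarrow> ('a \<Rightarrow> ereal) \<Rightarrow>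
      ('a \<Rightarrow> real) \<Rightarrow> ('a \<Rightarrow> real) \<Rightarrow> bool"
  where "prox_grad_step g \<xi> \<tau> M p u v \<longleftrightarrow> is_arg_min
    (\<lambda>y. enn2ereal (vexp_modular_bar M p (\<lambda>t. y t - u t)) + ereal (\<tau> * \<xi> y) + ereal \<tau> * g y)
    (\<lambda>y. y \<in> vexp_space M p) v"

locale composite_problem = variable_exponent M p a b
  for M :: "'a measure" and p :: "'a \<Rightarrow> ereal" and a b :: real +
  fixes f g :: "('a \<Rightarrow> real) \<Rightarrow> ereal"
    and G :: "('a \<Rightarrow> real) \<Rightarrow> ('a \<Rightarrow> real) \<Rightarrow> real"
    and q K :: real
  assumes b_le_2: "b \<le> 2" and b_le_q: "b \<le> q" and K_pos: "0 < K"
    and convex_f: "convex_functional M p f"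
    and gradient: "has_gateaux_gradient M p f G"
    and proper_g: "proper_functional M p g" and convex_g: "convex_functional M p g"
    and hoelder: "\<And>u v. u \<in> L \<Longrightarrow> v \<in> L \<Longrightarrow>
      vexp_dual_norm M p (\<lambda>w. G u w - G v w) \<le> K * norm_L (\<lambda>t. u t - v t) powr (q - 1)"
begin

abbreviation f_real :: "('a \<Rightarrow> real) \<Rightarrow> real"
  where "f_real u \<equiv> real_of_ereal (f u)"

abbreviation g_real :: "('a \<Rightarrow> real) \<Rightarrow> real"
  where "g_real u \<equiv> real_of_ereal (g u)"

text \<open>This represents the objective only where \<open>g\<close> is finite, since
  \<open>real_of_ereal\<close> sends infinity to 0; hence the conditions
  \<open>g u \<noteq> \<infinity>\<close> below.\<close>

definition F :: "('a \<Rightarrow> real) \<Rightarrow> real"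
  where "F u = f_real u + g_real u"

lemma g_finite:
  assumes "u \<in> L" "g u \<noteq> \<infinity>"
  shows "g u = ereal (g_real u)"
proof -
  have "g u \<noteq> -\<infinity>"
    using proper_g assms(1) unfolding proper_functional_def ext_functional_def by blast
  then show ?thesis using assms(2) by (cases "g u") auto
qed

lemma sum_eq_F:
  assumes "u \<in> L" "g u \<noteq> \<infinity>"
  shows "f u + g u = ereal (F u)"
proof -
  obtain c d where "f u = ereal c" "g u = ereal d"
    using gateaux_finite[OF gradient assms(1)] g_finite[OF assms] by blast
  then show ?thesis by (simp add: F_def)
qed

lemma convex_g_real:
  assumes "u \<in> L" "v \<in> L" "g u \<noteq> \<infinity>" "g v \<noteq> \<infinity>" "0 < s" "s < 1"
  shows "g (\<lambda>t. s * u t + (1 - s) * v t) \<le> ereal (s * g_real u + (1 - s) * g_real v)"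
proof -
  have "g (\<lambda>t. s * u t + (1 - s) * v t) \<le> ereal s * g u + ereal (1 - s) * g v"
    using convex_g assms unfolding convex_functional_def by blast
  moreover obtain c c' where "g u = ereal c" "g v = ereal c'"
    using g_finite[OF assms(1,3)] g_finite[OF assms(2,4)] by blast
  ultimately show ?thesis by simp
qed

context
  fixes \<tau> :: real and u v :: "'a \<Rightarrow> real"
  assumes \<tau>: "0 < \<tau>" and u: "u \<in> L" and step: "prox_grad_step g (G u) \<tau> M p u v"
begin

abbreviation d :: "'a \<Rightarrow> real"
  where "d \<equiv> \<lambda>t. v t - u t"

lemma step_mem: "v \<in> L"
  using step by (simp add: prox_grad_step_def is_arg_min_def)

lemma objective_eq:
  assumes "y \<in> L"
  shows "enn2ereal (vexp_modular_bar M p (\<lambda>t. y t - u t)) + ereal (\<tau> * G u y) + ereal \<tau> * g y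
    = ereal (modular_bar (\<lambda>t. y t - u t) + \<tau> * G u y) + ereal \<tau> * g y"
  using modular_bar_eq[OF space_diff[OF assms u]] modular_bar_nonneg
  by (simp add: enn2ereal_ennreal)

lemma step_le:
  assumes "y \<in> L"
  shows "ereal (modular_bar d + \<tau> * G u v) + ereal \<tau> * g v
    \<le> ereal (modular_bar (\<lambda>t. y t - u t) + \<tau> * G u y) + ereal \<tau> * g y"
proof -
  have "enn2ereal (vexp_modular_bar M p d) + ereal (\<tau> * G u v) + ereal \<tau> * g v
      \<le> enn2ereal (vexp_modular_bar M p (\<lambda>t. y t - u t)) + ereal (\<tau> * G u y) + ereal \<tau> * g y"
    using step assms unfolding prox_grad_step_def is_arg_min_linorder by blast
  then show ?thesis unfolding objective_eq[OF assms] objective_eq[OF step_mem] .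
qed

text \<open>Properness of \<open>g\<close> provides a competitor of finite cost, so a minimiser
  cannot have infinite cost, even if \<open>g u\<close> is infinite.\<close>

lemma step_finite: "g v \<noteq> \<infinity>"
proof
  assume inf: "g v = \<infinity>"
  obtain y where y: "y \<in> L" "g y \<noteq> \<infinity>"
    using proper_g by (auto simp: proper_functional_def)
  obtain c where "g y = ereal c" using g_finite[OF y] by blast
  then show False using step_le[OF y(1)] \<tau> inf by simp
qed

lemma step_le_real:
  assumes y: "y \<in> L" and c: "g y \<le> ereal c"
  shows "modular_bar d + \<tau> * G u v + \<tau> * g_real v \<le> modular_bar (\<lambda>t. y t - u t) + \<tau> * G u y + \<tau> * c"
proof -
  have "g y \<noteq> \<infinity>" using c by auto
  then obtain c' where c': "g y = ereal c'" using g_finite[OF y] by blast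
  obtain cv where "g v = ereal cv" using g_finite[OF step_mem step_finite] by blast
  then have "modular_bar d + \<tau> * G u v + \<tau> * g_real v \<le> modular_bar (\<lambda>t. y t - u t) + \<tau> * G u y + \<tau> * c'"
    using step_le[OF y] c' by simp
  also have "\<tau> * c' \<le> \<tau> * c"
    using c c' \<tau> by (intro mult_left_mono) auto
  finally show ?thesis by simp
qed

text \<open>The optimality condition at \<open>v\<close> in direction \<open>u - v\<close>, obtained by letting \<open>s \<rightarrow> 0\<close> along
  \<open>v + s (u - v)\<close>.\<close>

lemma step_first_order:
  assumes gu: "g u \<noteq> \<infinity>"
  shows "modular d + \<tau> * (G u v - G u u) + \<tau> * g_real v \<le> \<tau> * g_real u"
proof -
  note v = step_mem
  let ?D = "modular d + \<tau> * (G u v - G u u) + \<tau> * g_real v - \<tau> * g_real u"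
  \<comment> \<open>The competitor \<open>?z\<close> yields \<open>?D\<close> times \<open>s\<close>
    with an error quadratic in \<open>s\<close>; dividing by \<open>s\<close> leaves an error that
    vanishes in the limit.\<close>
  have "?D \<le> s * modular d" if s: "0 < s" "s < 1" for s
  proof -
    let ?z = "\<lambda>t. s * u t + (1 - s) * v t"
    have "modular_bar d + \<tau> * G u v + \<tau> * g_real v
        \<le> modular_bar (\<lambda>t. ?z t - u t) + \<tau> * G u ?z + \<tau> * (s * g_real u + (1 - s) * g_real v)"
      by (rule step_le_real[OF space_comb[OF u v] convex_g_real[OF u v gu step_finite s]])
    also have "(\<lambda>t. ?z t - u t) = (\<lambda>t. (1 - s) * d t)" by (simp add: fun_eq_iff algebra_simps)
    also have "modular_bar (\<lambda>t. (1 - s) * d t) \<le> modular_bar d - s * modular d + s\<^sup>2 * modular d"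
      by (rule modular_bar_shrink_le[OF space_diff[OF v u] s b_le_2])
    also have "G u ?z = s * G u u + (1 - s) * G u v"
      by (rule dual_comb[OF gateaux_dual[OF gradient u] u v])
    finally have "s * ?D \<le> s * (s * modular d)" by (simp add: algebra_simps power2_eq_square)
    then show ?thesis using s by simp
  qed
  moreover have "((\<lambda>s. s * modular d) \<longlongrightarrow> 0 * modular d) (at_right 0)"
    by (intro tendsto_intros)
  moreover have "\<forall>\<^sub>F s in at_right (0::real). s < 1 \<and> 0 < s"
    by (rule eventually_at_rightI[of 0 1]) auto
  ultimately have "?D \<le> 0 * modular d"
    by (intro tendsto_lowerbound[where F = "at_right 0"]) (auto elim: eventually_mono)
  then show ?thesis by simp
qed

context
  fixes \<delta> :: real
  assumes \<delta>: "0 < \<delta>" "\<delta> < 1" and \<tau>_le: "\<tau> \<le> q * (1 - \<delta>) / K" and small: "modular d \<le> 1"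
begin

text \<open>In \<open>hoelder_descent\<close> the power of the norm is at most
  \<open>modular d\<close> because the step is small, and the step size bound says exactly
  \<open>\<tau> * K / q \<le> 1 - \<delta>\<close>.\<close>

lemma step_descent: "\<tau> * f_real v \<le> \<tau> * (f_real u + (G u v - G u u)) + (1 - \<delta>) * modular d"
proof -
  have q: "q \<ge> 1" using b_le_q bounds by simp
  have "f_real v \<le> f_real u + (G u v - G u u) + K / q * norm_L d powr q"
    by (rule hoelder_descent[OF gradient _ hoelder q u step_mem]) (use K_pos in auto)
  also have "K / q * norm_L d powr q \<le> K / q * modular d"
    using norm_powr_le_modular[OF space_diff[OF step_mem u] small b_le_q] K_pos q
    by (intro mult_left_mono) auto
  finally have "f_real v \<le> f_real u + (G u v - G u u) + K / q * modular d" by simp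
  then have "\<tau> * f_real v \<le> \<tau> * (f_real u + (G u v - G u u) + K / q * modular d)"
    using \<tau> by (intro mult_left_mono) auto
  moreover have "\<tau> * (K / q) \<le> 1 - \<delta>"
    using \<tau>_le K_pos q by (simp add: field_simps)
  then have "\<tau> * (K / q) * modular d \<le> (1 - \<delta>) * modular d"
    by (rule mult_right_mono) (rule modular_nonneg)
  ultimately show ?thesis by (simp add: algebra_simps)
qed

text \<open>Adding \<open>step_first_order\<close> and \<open>step_descent\<close> cancels the
  gradient terms, and \<open>modular d\<close> survives with weight
  \<open>1 - (1 - \<delta>) = \<delta>\<close>.\<close>

lemma step_sufficient_decrease:
  assumes "g u \<noteq> \<infinity>"
  shows "\<delta> * modular d \<le> \<tau> * (F u - F v)"
  using step_first_order[OF assms] step_descent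
  unfolding F_def distrib_left left_diff_distrib right_diff_distrib mult_1 by linarith

lemma step_decrease:
  assumes "g u \<noteq> \<infinity>"
  shows "F v \<le> F u"
proof -
  have "0 \<le> \<delta> * modular d" using \<delta> modular_nonneg[of d] by simp
  then have "0 \<le> \<tau> * (F u - F v)" using step_sufficient_decrease[OF assms] by linarith
  then show ?thesis using \<tau> by (simp add: zero_le_mult_iff)
qed

text \<open>Comparison with the point \<open>u + s (w - u)\<close>. Its proximal cost is of order \<open>s\<^sup>a\<close>, and the
  leftover \<open>(1 - \<delta>) modular d\<close> is absorbed by the sufficient decrease.\<close>

lemma step_contraction:
  assumes gu: "g u \<noteq> \<infinity>" and w: "w \<in> L" and gw: "g w \<noteq> \<infinity>" and s: "0 < s" "s < 1"
  shows "F v - F w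
    \<le> (1 - \<delta> * s) * (F u - F w) + \<delta> / \<tau> * modular (\<lambda>t. w t - u t) * s powr a"
proof -
  note v = step_mem
  let ?z = "\<lambda>t. s * w t + (1 - s) * u t"
  let ?R = "modular (\<lambda>t. w t - u t)"
  have "modular_bar d + \<tau> * G u v + \<tau> * g_real v
      \<le> modular_bar (\<lambda>t. ?z t - u t) + \<tau> * G u ?z + \<tau> * (s * g_real w + (1 - s) * g_real u)"
    by (rule step_le_real[OF space_comb[OF w u] convex_g_real[OF w u gw gu s]])
  also have "(\<lambda>t. ?z t - u t) = (\<lambda>t. s * (w t - u t))" by (simp add: fun_eq_iff algebra_simps)
  also have "modular_bar (\<lambda>t. s * (w t - u t)) \<le> s powr a * ?R"
    by (rule modular_bar_cmult_le[OF space_diff[OF w u] s])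
  also have "G u ?z = s * G u w + (1 - s) * G u u"
    by (rule dual_comb[OF gateaux_dual[OF gradient u] w u])
  finally have 1: "\<tau> * (G u v - G u u + g_real v)
      \<le> s powr a * ?R + \<tau> * (s * (G u w - G u u + g_real w) + (1 - s) * g_real u)"
    using modular_bar_nonneg[of d]
    unfolding distrib_left distrib_right left_diff_distrib right_diff_distrib mult_1 by linarith
  \<comment> \<open>Of \<open>f_real u\<close>, the share \<open>s\<close> joins the linear term at
    \<open>w\<close> and is bounded by \<open>f_real w\<close>; the share \<open>1 - s\<close>
    completes \<open>F u\<close>.\<close>
  have "\<tau> * s * (f_real u + (G u w - G u u)) \<le> \<tau> * s * f_real w"
    using gradient_inequality[OF gradient convex_f u w] \<tau> s by (intro mult_left_mono) auto
  with 1 step_descent have 2: "\<tau> * F v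
      \<le> \<tau> * (s * F w + (1 - s) * F u) + s powr a * ?R + (1 - \<delta>) * modular d"
    unfolding F_def distrib_left distrib_right left_diff_distrib right_diff_distrib mult_1 mult.assoc
    by linarith
  \<comment> \<open>Weights \<open>1 - \<delta>\<close> for the sufficient decrease and
    \<open>\<delta>\<close> for inequality \<open>2\<close> cancel \<open>modular d\<close> and sum
    to one on \<open>F v\<close>; the weight \<open>\<delta>\<close> turns the factor
    \<open>1 - s\<close> into \<open>1 - \<delta> * s\<close>.\<close>
  have "(1 - \<delta>) * (\<delta> * modular d) \<le> (1 - \<delta>) * (\<tau> * (F u - F v))"
    using step_sufficient_decrease[OF gu] \<delta> by (intro mult_left_mono) auto
  moreover have "\<delta> * (\<tau> * F v)
      \<le> \<delta> * (\<tau> * (s * F w + (1 - s) * F u) + s powr a * ?R + (1 - \<delta>) * modular d)"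
    using 2 \<delta> by (intro mult_left_mono) auto
  moreover have "\<tau> * ((1 - \<delta> * s) * (F u - F w)) + \<delta> * s powr a * ?R - \<tau> * (F v - F w)
      = \<delta> * (\<tau> * (s * F w + (1 - s) * F u) + s powr a * ?R + (1 - \<delta>) * modular d) - \<delta> * (\<tau> * F v)
        + ((1 - \<delta>) * (\<tau> * (F u - F v)) - (1 - \<delta>) * (\<delta> * modular d))"
    by algebra
  ultimately have "\<tau> * (F v - F w) \<le> \<tau> * ((1 - \<delta> * s) * (F u - F w)) + \<delta> * s powr a * ?R"
    by linarith
  then have "F v - F w \<le> (\<tau> * ((1 - \<delta> * s) * (F u - F w)) + \<delta> * s powr a * ?R) / \<tau>"
    using \<tau> by (simp add: pos_le_divide_eq mult.commute)
  also have "\<dots> = (1 - \<delta> * s) * (F u - F w) + \<delta> / \<tau> * ?R * s powr a"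
    using \<tau> by (simp add: field_simps)
  finally show ?thesis .
qed

end

end

section \<open>The rate along the generated sequence\<close>

text \<open>Boundedness of the iterates bounds \<open>modular (w - x k)\<close> uniformly and
  \<open>\<tau>bar\<close> bounds \<open>\<delta> / \<tau> k\<close>, so every step obeys the same
  scalar recursion. Here \<open>w\<close> is any point with finite \<open>g\<close>;
  \<open>sublinear_rate\<close> tolerates negative gaps.\<close>

lemma mpg_rate:
  assumes a: "1 < a" and \<tau>bar: "0 < \<tau>bar" and \<delta>: "0 < \<delta>" "\<delta> < 1"
    and \<tau>_ge: "\<And>k. \<tau>bar \<le> \<tau> k" and \<tau>_le: "\<And>k. \<tau> k \<le> q * (1 - \<delta>) / K"
    and seq: "mpg_sequence M p G g \<tau> x" and B: "\<And>k. norm_L (x k) \<le> B"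
    and w: "w \<in> L" "g w \<noteq> \<infinity>"
  shows "\<exists>\<eta>>0. \<forall>k\<ge>1. (f (x k) + g (x k)) - (f w + g w)
    \<le> ereal (\<eta> * (1 / real k powr (a - 1)))"
proof -
  have \<tau>: "0 < \<tau> k" for k using \<tau>bar \<tau>_ge[of k] by simp
  have step: "prox_grad_step g (G (x k)) (\<tau> k) M p (x k) (x (Suc k))" for k
    using seq unfolding mpg_sequence_def prox_grad_step_def by blast
  have x: "x k \<in> L" for k
  proof (cases k)
    case 0
    then show ?thesis using seq by (simp add: mpg_sequence_def)
  next
    case (Suc n)
    then show ?thesis using step[of n] by (simp add: prox_grad_step_def is_arg_min_def)
  qed
  have small: "modular (\<lambda>t. x (Suc k) t - x k t) \<le> 1" for k
  proof -
    have "vexp_modular M p (\<lambda>t. x k t - x (Suc k) t) < 1"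
      using seq unfolding mpg_sequence_def by blast
    moreover have "modular (\<lambda>t. x k t - x (Suc k) t) = modular (\<lambda>t. x (Suc k) t - x k t)"
      by (simp add: modular_def abs_minus_commute)
    ultimately show ?thesis
      using modular_eq[OF space_diff[OF x x]] by (simp add: ennreal_less_one_iff)
  qed
  \<comment> \<open>The starting point may have infinite \<open>g\<close>; each later iterate is a
    minimiser, so the recursion starts at index 1.\<close>
  have fin: "g (x k) \<noteq> \<infinity>" if "k \<ge> 1" for k
    using step_finite[OF \<tau> x step, of "k - 1"] that by simp
  \<comment> \<open>\<open>B + 1\<close> instead of \<open>B\<close> provides the strict norm bound
    that \<open>modular_le_of_norm_less\<close> asks for.\<close>
  define R where "R = 2 powr b * (modular w + max 1 (B + 1) powr b)"
  have R: "modular (\<lambda>t. w t - x k t) \<le> R" for k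
  proof -
    have "modular (x k) \<le> max 1 (B + 1) powr b"
      by (rule modular_le_of_norm_less[OF x]) (use B[of k] in simp)
    then have "2 powr b * (modular w + modular (x k)) \<le> R"
      unfolding R_def by (intro mult_left_mono) auto
    then show ?thesis using modular_diff_le[OF w(1) x[of k]] by linarith
  qed
  have R0: "0 \<le> R" unfolding R_def using modular_nonneg by simp
  have "\<exists>\<eta>>0. \<forall>k\<ge>1. F (x k) - F w \<le> \<eta> * (1 / real k powr (a - 1))"
  proof (rule sublinear_rate)
    show "1 < a" "a \<le> 2" "0 < \<delta>" "\<delta> \<le> 1" using a bounds b_le_2 \<delta> by auto
    show "0 \<le> \<delta> / \<tau>bar * R" using \<delta> \<tau>bar R0 by simp
    fix k :: nat assume k: "k \<ge> 1"
    show "F (x (Suc k)) - F w \<le> F (x k) - F w"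
      using step_decrease[OF \<tau> x step \<delta> \<tau>_le small fin[OF k]] by simp
    fix s :: real assume s: "0 < s" "s < 1"
    have "\<delta> / \<tau> k * modular (\<lambda>t. w t - x k t) \<le> \<delta> / \<tau>bar * R"
      using \<delta> \<tau>bar \<tau>_ge[of k] R[of k] R0 modular_nonneg
      by (intro mult_mono divide_left_mono) auto
    then have "\<delta> / \<tau> k * modular (\<lambda>t. w t - x k t) * s powr a \<le> \<delta> / \<tau>bar * R * s powr a"
      by (rule mult_right_mono) simp
    then show "F (x (Suc k)) - F w \<le> (1 - \<delta> * s) * (F (x k) - F w) + \<delta> / \<tau>bar * R * s powr a"
      using step_contraction[OF \<tau> x step \<delta> \<tau>_le small fin[OF k] w s] by linarith
  qed
  then show ?thesis using sum_eq_F[OF x fin] sum_eq_F[OF w] by simp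
qed

end

theorem proposition3p4:
  fixes \<Omega> :: "(real ^ 'n) set"
    and p :: "real ^ 'n \<Rightarrow> ereal"
    and f g \<phi> :: "(real ^ 'n \<Rightarrow> real) \<Rightarrow> ereal"
    and grad_f :: "(real ^ 'n \<Rightarrow> real) \<Rightarrow> ((real ^ 'n \<Rightarrow> real) \<Rightarrow> real)"
    and x :: "nat \<Rightarrow> real ^ 'n \<Rightarrow> real"
    and \<tau> :: "nat \<Rightarrow> real"
    and q K \<tau>bar \<delta> :: real
    and M :: "(real ^ 'n) measure"
    and p_minus p_plus \<phi>bar :: ereal
    and L :: "(real ^ 'n \<Rightarrow> real) set"
  defines "M \<equiv> lebesgue_on \<Omega>"
    and "L \<equiv> vexp_space M p"
    and "p_minus \<equiv> essinf M p"
    and "p_plus \<equiv> esssup M p"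
    and "\<phi> \<equiv> (\<lambda>u. f u + g u)"
    and "\<phi>bar \<equiv> (INF u\<in>L. \<phi> u)"
  assumes "\<Omega> \<in> sets lebesgue" and "emeasure lebesgue \<Omega> > 0"
    and "p \<in> borel_measurable M" and "\<And>t. t \<in> \<Omega> \<Longrightarrow> 1 \<le> p t"
    and "1 < p_minus" and "p_minus \<le> p_plus" and "p_plus \<le> 2"
    and "proper_functional M p f" and "convex_functional M p f"
    and "has_gateaux_gradient M p f grad_f"
    and "proper_functional M p g" and "convex_functional M p g" and "lsc_functional M p g"
    and "{u \<in> L. \<phi> u = \<phi>bar} \<noteq> {}"
    and "p_plus \<le> ereal q" and "q \<le> 2" and "0 < K"
    and "\<And>u v. u \<in> L \<Longrightarrow> v \<in> L \<Longrightarrow>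
      vexp_dual_norm M p (\<lambda>w. grad_f u w - grad_f v w)
        \<le> K * vexp_norm M p (\<lambda>t. u t - v t) powr (q - 1)"
    and "0 < \<tau>bar" and "0 < \<delta>" and "\<delta> < 1"
    and "\<And>k. \<tau>bar \<le> \<tau> k" and "\<And>k. \<tau> k \<le> q * (1 - \<delta>) / K"
    and "mpg_sequence M p grad_f g \<tau> x"
    and "\<exists>B. \<forall>k. vexp_norm M p (x k) \<le> B"
  shows "\<exists>\<eta>>0. \<forall>k\<ge>1. \<phi> (x k) - \<phi>bar
    \<le> ereal (\<eta> * (1 / real k powr (real_of_ereal p_minus - 1)))"
proof -
  have bounds: "1 < p_minus" "p_minus \<le> p_plus" "p_plus \<le> 2" by fact+
  obtain a where a: "p_minus = ereal a" using bounds by (cases p_minus) auto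
  obtain b where b: "p_plus = ereal b" using bounds by (cases p_plus) (auto simp: a)
  have ab: "1 < a" "a \<le> b" "b \<le> 2" "b \<le> q"
    using bounds \<open>p_plus \<le> ereal q\<close> by (simp_all add: a b)
  have "AE t in M. - p t \<le> esssup M (\<lambda>t. - p t)" by (rule esssup_AE)
  then have lower: "AE t in M. ereal a \<le> p t"
  proof eventually_elim
    case (elim t)
    then show ?case
      using a unfolding p_minus_def essinf_def by (metis ereal_uminus_le_reorder)
  qed
  moreover have "AE t in M. p t \<le> ereal b"
    using esssup_AE[of p M] b unfolding p_plus_def by simp
  ultimately have AE: "AE t in M. ereal a \<le> p t \<and> p t \<le> ereal b" by eventually_elim simp
  interpret composite_problem M p a b f g grad_f q K
  proof
    show "\<And>u v. u \<in> vexp_space M p \<Longrightarrow> v \<in> vexp_space M p \<Longrightarrow>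
      vexp_dual_norm M p (\<lambda>w. grad_f u w - grad_f v w)
        \<le> K * vexp_norm M p (\<lambda>t. u t - v t) powr (q - 1)"
      using assms(24) unfolding L_def .
  qed (use ab AE assms in auto)
  obtain w where w: "w \<in> L" "\<phi> w = \<phi>bar" using \<open>{u \<in> L. \<phi> u = \<phi>bar} \<noteq> {}\<close> by blast
  \<comment> \<open>The equation \<open>\<phi> w = \<phi>bar\<close> alone leaves open that both
    sides are infinite; comparison with a point of finite \<open>g\<close> excludes this.\<close>
  obtain y where y: "y \<in> L" "g y \<noteq> \<infinity>"
    using \<open>proper_functional M p g\<close> unfolding L_def proper_functional_def by blast
  have "\<phi> w \<le> \<phi> y" unfolding w(2) \<phi>bar_def by (rule INF_lower[OF y(1)])
  also have "\<phi> y < \<infinity>" using sum_eq_F y unfolding \<phi>_def L_def by simp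
  finally have gw: "g w \<noteq> \<infinity>" unfolding \<phi>_def by auto
  obtain B where B: "\<And>k. vexp_norm M p (x k) \<le> B"
    using \<open>\<exists>B. \<forall>k. vexp_norm M p (x k) \<le> B\<close> by blast
  show ?thesis
    using mpg_rate[OF ab(1) \<open>0 < \<tau>bar\<close> \<open>0 < \<delta>\<close> \<open>\<delta> < 1\<close> assms(28,29)
        \<open>mpg_sequence M p grad_f g \<tau> x\<close> B w(1)[unfolded L_def] gw] w(2)
    by (simp add: \<phi>_def a)
qed

end
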